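(* Let $p$ be a symmetric nc polynomial of degree $d$ in $g$ symmetric variables, let $\nu=1+g+\cdots+g^{d-2}$, and fix a positive integer $k$. Suppose $n>g\frac{\nu(\nu-1)}{2}$, $X\in(\mathbb{R}^{n\times n}_{sym})^g$, $v\in\mathbb{R}^n$, and there does not exist a nonzero nc polynomial $q$ (not necessarily symmetric) of degree less than or equal to $d-2$ such that $q(X)v=0$. If $\mathcal H$ is a subspace of $(\mathbb{R}^{n\times n}_{sym})^g$ of codimension at most $kn$ and if the Hessian of $p$ is positive relative to $\mathcal H$ at $(X,v)$, then $\sigma_-^{min}(p'')<k+1$.
   Context: An nc polynomial is an element of the free algebra $\mathbb{R}\langle x\rangle$ in noncommuting variables $x_1,\dots,x_g$ with real coefficients. The involution $T$ is the linear map with $x_j^T=x_j$ (and $h_j^T=h_j$) that reverses words; $p$ is symmetric if $p^T=p$. $(\mathbb{R}^{n\times n}_{sym})^g$ is the set of $g$-tuples of real symmetric $n\times n$ matrices, at which nc polynomials are evaluated by substitution. The Hessian $p''(x)[h]=\frac{d^2}{dt^2}p(x+th)|_{t=0}$ is an nc polynomial in the $2g$ variables $x_1,\dots,x_g,h_1,\dots,h_g$. The Hessian of $p$ is positive relative to a subspace $\mathcal H\subset(\mathbb{R}^{n\times n}_{sym})^g$ at $(X,v)$ if $\langle p''(X)[H]v,v\rangle\ge0$ for each $H\in\mathcal H$. For a symmetric nc polynomial $f$, $\sigma_-^{min}(f)$ is the smallest number $\sigma_-$ of negative squares in a representation $f=\sum_{j=1}^{\sigma_+}(f_j^+)^Tf_j^+-\sum_{\ell=1}^{\sigma_-}(f_\ell^-)^Tf_\ell^-$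 with nc polynomials $f_j^+,f_\ell^-$; for $f=p''(x)[h]$ these are polynomials in $(x,h)$. *)

theory Defs
  imports "HOL-Analysis.Analysis" "HOL-Analysis.Finite_Function_Topology"
begin

section \<open>The free algebra\<close>

text \<open>
  Words are the free monoid, written additively because the multiplication of
  \<^theory>\<open>HOL-Library.Poly_Mapping\<close> is the convolution over an additive (here
  noncommutative) monoid of exponents. With real coefficients this multiplication makes
  the finitely supported functions on words the free algebra, with the empty word \<open>0\<close>
  as unit. Its real vector space structure and norm (the sum of the absolute
  values of the coefficients) come from \<^theory>\<open>HOL-Analysis.Finite_Function_Topology\<close>.
\<close>

datatype 'a ncword = NCWord (letters: "'a list")

instantiation ncword :: (type) monoid_add
begin

definition zero_ncword :: "'a ncword" where
  "0 = NCWord []"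

definition plus_ncword :: "'a ncword \<Rightarrow> 'a ncword \<Rightarrow> 'a ncword" where
  "u + w = NCWord (letters u @ letters w)"

instance
  by standard (simp_all add: zero_ncword_def plus_ncword_def)

end

type_synonym 'a ncpoly = "'a ncword \<Rightarrow>\<^sub>0 real"

definition nc_var :: "'a \<Rightarrow> 'a ncpoly" where
  "nc_var j = Poly_Mapping.single (NCWord [j]) 1"

text \<open>The zero polynomial gets degree \<open>0\<close>.\<close>

definition nc_degree :: "'a ncpoly \<Rightarrow> nat" where
  "nc_degree p = Max (insert 0 ((\<lambda>w. length (letters w)) ` Poly_Mapping.keys p))"

text \<open>
  The involution reverses words. Since reversal is its own inverse, the coefficient
  of \<open>w\<close> in the transpose of \<open>p\<close> is the coefficient of the reversed word in \<open>p\<close>.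
\<close>

definition nc_transpose :: "'a ncpoly \<Rightarrow> 'a ncpoly" where
  "nc_transpose p = Poly_Mapping.map_key (\<lambda>w. NCWord (rev (letters w))) p"

definition nc_symmetric :: "'a ncpoly \<Rightarrow> bool" where
  "nc_symmetric p \<longleftrightarrow> nc_transpose p = p"

definition nc_subst :: "('a \<Rightarrow> 'b ncpoly) \<Rightarrow> 'a ncpoly \<Rightarrow> 'b ncpoly" where
  "nc_subst f p =
    (\<Sum>w\<in>Poly_Mapping.keys p. Poly_Mapping.lookup p w *\<^sub>R prod_list (map f (letters w)))"

text \<open>
  Evaluation at matrices. The class multiplication on \<open>real^'n^'n\<close> is entrywise, so
  the matrix product has to be folded explicitly.
\<close>

definition nc_eval :: "('a \<Rightarrow> real^'n^'n) \<Rightarrow> 'a ncpoly \<Rightarrow> real^'n^'n" where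
  "nc_eval X p =
    (\<Sum>w\<in>Poly_Mapping.keys p.
      Poly_Mapping.lookup p w *\<^sub>R foldr (\<lambda>j M. X j ** M) (letters w) (mat 1))"


section \<open>The Hessian\<close>

text \<open>
  The variables \<open>x\<^sub>j\<close> and \<open>h\<^sub>j\<close> are indexed by \<open>Inl j\<close> and \<open>Inr j\<close>. The second derivative
  is that of the curve \<open>t \<mapsto> p(x + t h)\<close> in the normed space of nc polynomials in \<open>(x, h)\<close>;
  the curve is polynomial in \<open>t\<close>.
\<close>

definition nc_hessian :: "'a ncpoly \<Rightarrow> ('a + 'a) ncpoly" where
  "nc_hessian p =
    vector_derivative
      (\<lambda>t. vector_derivative
        (\<lambda>s::real. nc_subst (\<lambda>j. nc_var (Inl j) + s *\<^sub>R nc_var (Inr j)) p) (at t))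
      (at 0)"

definition sym_tuples :: "(real^'n^'n^'g) set" where
  "sym_tuples = {X. \<forall>j. transpose (X $ j) = X $ j}"

definition hessian_positive_on ::
  "'g ncpoly \<Rightarrow> (real^'n^'n^'g) set \<Rightarrow> real^'n^'n^'g \<Rightarrow> real^'n \<Rightarrow> bool" where
  "hessian_positive_on p \<H> X v \<longleftrightarrow>
    (\<forall>H\<in>\<H>. (nc_eval (case_sum (($) X) (($) H)) (nc_hessian p) *v v) \<bullet> v \<ge> 0)"


section \<open>Sums and differences of squares\<close>

text \<open>
  For symmetric \<open>f\<close> a representation always exists, because
  \<open>4 f = (f + 1)\<^sup>T (f + 1) - (f - 1)\<^sup>T (f - 1)\<close>, so the least number is attained.
\<close>

definition sigma_minus_min :: "'a ncpoly \<Rightarrow> nat" where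
  "sigma_minus_min f =
    (LEAST m. \<exists>fp fm. length fm = m \<and>
      f = (\<Sum>q\<leftarrow>fp. nc_transpose q * q) - (\<Sum>q\<leftarrow>fm. nc_transpose q * q))"

end

theory Submission
  imports Defs
begin

text \<open>
  Let \<open>c\<^sub>r\<close> be the Taylor coefficients of \<open>(1 - t)\<close> to the power \<open>-1/2\<close>, so that the convolution of
  \<open>c\<close> with itself is constantly \<open>1\<close>. For a nonempty word \<open>y\<close> put
  \<open>W\<^sub>y = \<Sum>\<^sub>r c\<^sub>r y\<^sub>r\<close>, where \<open>y\<^sub>r\<close> is \<open>y\<close> with its letter in position \<open>r\<close> (counted from \<open>0\<close>)
  turned into an \<open>h\<close>. In the sum of \<open>W\<^sub>y\<^sup>T W\<^sub>z\<close> over all splittings of a word as \<open>y\<^sup>T z\<close>, every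
  choice of two letters \<open>h\<close> in that word then appears with coefficient \<open>1\<close>. So \<open>p''\<close> is
  \<open>\<Sum> A\<^sub>y\<^sub>z W\<^sub>y\<^sup>T W\<^sub>z\<close> with the constant matrix
  \<open>A\<^sub>y\<^sub>z\<close> = twice the coefficient of \<open>y\<^sup>T z\<close> in \<open>p\<close>. Diagonalizing \<open>A\<close> represents \<open>p''\<close> with \<open>m\<close>
  negative squares, \<open>m\<close> being the number of negative diagonal entries.

  To bound \<open>m\<close>, impose on \<open>H \<in> \<H>\<close> that the \<open>g\<nu> - m\<close> remaining squares vanish at
  \<open>(X, H, v)\<close>, which costs \<open>n\<close> linear conditions each. Positivity then forces
  all squares to vanish, hence all \<open>W\<^sub>y(X)[H] v\<close>, and by induction on the length of words
  \<open>H\<^sub>j w(X) v = 0\<close> for all words \<open>w\<close> of length at most \<open>d - 2\<close>. As these \<open>\<nu>\<close> vectors \<open>w(X) v\<close> are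
  independent, such \<open>H\<close> form a subspace of codimension \<open>g (n\<nu> - \<nu>(\<nu> - 1)/2)\<close> in the symmetric
  tuples. Comparing dimensions gives \<open>m n \<le> k n + g \<nu>(\<nu> - 1)/2 < (k + 1) n\<close>.
\<close>

section \<open>Dimension counts\<close>

text \<open>Rank-nullity inside \<open>S\<close>: \<open>f\<close> is injective on the orthogonal
  complement \<open>?C\<close> of the kernel in \<open>S\<close>, and removing kernel components
  shows that \<open>?C\<close> already has the full image.\<close>

lemma dim_kernel_on:
  fixes f :: "'a::euclidean_space \<Rightarrow> 'b::euclidean_space"
  assumes "linear f" "subspace S"
  shows "dim {x \<in> S. f x = 0} + dim (f ` S) = dim S"
proof -
  let ?K = "{x \<in> S. f x = 0}"
  let ?C = "{y \<in> S. \<forall>x \<in> ?K. orthogonal x y}"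
  have K: "subspace ?K"
    using assms by (auto simp: subspace_def linear_add linear_scale linear_0)
  have dC: "dim ?C + dim ?K = dim S"
    by (rule dim_subspace_orthogonal_to_vectors[OF K assms(2)]) auto
  have C: "subspace ?C"
    using assms(2) by (auto simp: subspace_def orthogonal_def inner_add_right)
  have "inj_on f ?C"
  proof (rule inj_onI)
    fix x y assume xy: "x \<in> ?C" "y \<in> ?C" "f x = f y"
    then have "x - y \<in> ?C" using subspace_diff[OF C] by blast
    moreover have "x - y \<in> ?K" using xy assms
      by (auto simp: linear_diff intro: subspace_diff)
    ultimately show "x = y" by (auto simp: orthogonal_self)
  qed
  then have dimC: "dim (f ` ?C) = dim ?C"
    using C assms(1) by (intro dim_image_eq) (auto simp: span_eq_iff[THEN iffD2])
  have "f x \<in> f ` ?C" if "x \<in> S" for x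
  proof -
    obtain y z where yz: "y \<in> span ?K" "\<And>w. w \<in> span ?K \<Longrightarrow> orthogonal z w" "x = y + z"
      using orthogonal_subspace_decomp_exists[of ?K x] by blast
    have y: "y \<in> ?K" using yz(1) K by (simp add: span_eq_iff[THEN iffD2])
    have "z = x - y" using yz(3) by simp
    then have "z \<in> S" using that y subspace_diff[OF assms(2)] by auto
    moreover have "\<forall>w\<in>?K. orthogonal w z"
      using yz(2) span_superset[of ?K] by (meson orthogonal_commute subsetD)
    ultimately have "z \<in> ?C" by blast
    moreover have "f x = f z" using yz(3) y assms(1) by (simp add: linear_add)
    ultimately show ?thesis by blast
  qed
  then have "f ` S = f ` ?C" by auto
  then show ?thesis using dC dimC by simp
qed

lemma dim_common_kernel_ge:
  fixes f :: "'i \<Rightarrow> 'a::euclidean_space \<Rightarrow> 'b::euclidean_space"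
  assumes "finite I" "\<And>i. i \<in> I \<Longrightarrow> linear (f i)" "subspace S"
  shows "dim S \<le> dim {x \<in> S. \<forall>i\<in>I. f i x = 0} + card I * DIM('b)"
  using assms(1,2)
proof (induction I rule: finite_induct)
  case (insert i I)
  let ?K = "{x \<in> S. \<forall>i\<in>I. f i x = 0}"
  have K: "subspace ?K"
    using assms(3) insert.prems by (auto simp: subspace_def linear_add linear_scale linear_0)
  have "dim {x \<in> ?K. f i x = 0} + dim (f i ` ?K) = dim ?K"
    by (rule dim_kernel_on[OF _ K]) (use insert.prems in auto)
  moreover have "dim (f i ` ?K) \<le> DIM('b)" by (rule dim_subset_UNIV)
  moreover have "{x \<in> ?K. f i x = 0} = {x \<in> S. \<forall>i\<in>insert i I. f i x = 0}" by auto
  moreover have "dim S \<le> dim ?K + card I * DIM('b)" using insert by auto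
  ultimately show ?case using insert.hyps by simp
qed simp

text \<open>The conditions are orthogonality to the vectors \<open>axis j b\<close>, of which there
  are at most \<open>CARD('g) * card B\<close>.\<close>

lemma dim_orthogonal_components_ge:
  fixes B :: "(real^'n) set"
  assumes "finite B"
  shows "CARD('g) * CARD('n) \<le> dim {y :: real^'n^'g::finite. \<forall>j. \<forall>b\<in>B. y $ j \<bullet> b = 0} + CARD('g) * card B"
proof -
  let ?A = "(\<lambda>(j, b). axis j b :: real^'n^'g) ` (UNIV \<times> B)"
  have "dim {y \<in> UNIV. \<forall>x\<in>span ?A. orthogonal x y} + dim (span ?A) = dim (UNIV :: (real^'n^'g) set)"
    by (rule dim_subspace_orthogonal_to_vectors) auto
  moreover have "{y \<in> UNIV. \<forall>x\<in>span ?A. orthogonal x y}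
      \<subseteq> {y :: real^'n^'g. \<forall>j. \<forall>b\<in>B. y $ j \<bullet> b = 0}"
  proof clarsimp
    fix y :: "real^'n^'g" and j b
    assume y: "\<forall>x\<in>span ?A. orthogonal x y" and b: "b \<in> B"
    have "axis j b \<in> ?A" using b by force
    then have "orthogonal (axis j b) y" using y span_base[of _ ?A] by blast
    then show "y $ j \<bullet> b = 0" by (metis inner_axis inner_commute orthogonal_def)
  qed
  moreover have "dim (span ?A) \<le> CARD('g) * card B"
  proof -
    have "dim (span ?A) \<le> card ?A" using assms by (simp add: dim_le_card')
    also have "\<dots> \<le> card ((UNIV :: 'g set) \<times> B)" using assms by (intro card_image_le) auto
    finally show ?thesis by (simp add: card_cartesian_product)
  qed
  ultimately show ?thesis
    using dim_subset[of "{y \<in> UNIV. \<forall>x\<in>span ?A. orthogonal x y}" "{y :: real^'n^'g. \<forall>j. \<forall>b\<in>B. y $ j \<bullet> b = 0}"]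
    by simp
qed

section \<open>Symmetric tuples annihilating given vectors\<close>

lemma subspace_sym_tuples: "subspace (sym_tuples :: (real^'n^'n^'g) set)"
  by (auto simp: subspace_def sym_tuples_def transpose_def vec_eq_iff)

definition sym_annihilator :: "(real^'n) set \<Rightarrow> (real^'n^'n^'g) set" where
  "sym_annihilator U = {H \<in> sym_tuples. \<forall>j. \<forall>u\<in>U. H $ j *v u = 0}"

text \<open>Allows an independent set to be replaced by an orthonormal basis of its span.\<close>

lemma sym_annihilator_span:
  fixes U :: "(real^'n) set"
  shows "sym_annihilator (span U) = sym_annihilator U"
proof -
  have "M *v u = 0" if "\<forall>u\<in>U. M *v u = 0" "u \<in> span U" for M :: "real^'n^'n" and u
    using that(2,1) by (induction rule: span_induct_alt)
      (auto simp: matrix_vector_right_distrib matrix_vector_mult_scaleR)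
  then show ?thesis
    unfolding sym_annihilator_def using span_superset[of U] by blast
qed

lemma subspace_sym_annihilator: "subspace (sym_annihilator U :: (real^'n^'n^'g) set)"
  using subspace_sym_tuples unfolding sym_annihilator_def subspace_def
  by (auto simp: matrix_vector_mult_add_rdistrib scaleR_matrix_vector_assoc[symmetric])

text \<open>For a unit vector \<open>u\<close> orthogonal to \<open>B\<close>, any \<open>y\<close> orthogonal to \<open>B\<close> is \<open>M u\<close> for the symmetric
  \<open>M = y u\<^sup>T + u y\<^sup>T - \<langle>y, u\<rangle> u u\<^sup>T\<close>, which vanishes on \<open>B\<close>.\<close>

lemma dim_sym_annihilator_insert:
  fixes B :: "(real^'n) set"
  assumes "finite B" "norm u = 1" "\<And>b. b \<in> B \<Longrightarrow> u \<bullet> b = 0"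
  shows "dim (sym_annihilator (insert u B) :: (real^'n^'n^'g) set) + CARD('g) * CARD('n)
    \<le> dim (sym_annihilator B :: (real^'n^'n^'g) set) + CARD('g) * card B"
proof -
  define f :: "real^'n^'n^'g \<Rightarrow> real^'n^'g" where "f H = (\<chi> j. H $ j *v u)" for H
  let ?S = "sym_annihilator B :: (real^'n^'n^'g) set"
  have lin: "linear f"
    by (rule linearI) (auto simp: f_def vec_eq_iff matrix_vector_mult_add_rdistrib
        scaleR_matrix_vector_assoc[symmetric])
  have ker: "{H \<in> ?S. f H = 0} = sym_annihilator (insert u B)"
    by (auto simp: sym_annihilator_def f_def vec_eq_iff)
  have "{y. \<forall>j. \<forall>b\<in>B. y $ j \<bullet> b = 0} \<subseteq> f ` ?S"
  proof
    fix y :: "real^'n^'g" assume y: "y \<in> {y. \<forall>j. \<forall>b\<in>B. y $ j \<bullet> b = 0}"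
    define H :: "real^'n^'n^'g" where
      "H = (\<chi> j i l. (y $ j) $ i * u $ l + u $ i * (y $ j) $ l - (y $ j \<bullet> u) * u $ i * u $ l)"
    have rank2: "(\<chi> i l. a $ i * u $ l + u $ i * a $ l - c * u $ i * u $ l) *v x
        = (u \<bullet> x) *\<^sub>R a + (a \<bullet> x - c * (u \<bullet> x)) *\<^sub>R u" for a x :: "real^'n" and c
      by (simp add: vec_eq_iff matrix_vector_mult_def inner_vec_def algebra_simps
          sum.distrib sum_subtractf sum_distrib_left)
    have mult: "H $ j *v x = (u \<bullet> x) *\<^sub>R (y $ j) + (y $ j \<bullet> x - (y $ j \<bullet> u) * (u \<bullet> x)) *\<^sub>R u" for j x
      by (simp add: H_def rank2)
    have uu: "u \<bullet> u = 1" using assms(2) by (simp add: norm_eq_1)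
    have "H \<in> sym_tuples"
      by (simp add: sym_tuples_def H_def transpose_def vec_eq_iff algebra_simps)
    then have "H \<in> ?S" using y assms(3) by (auto simp: sym_annihilator_def mult)
    moreover have "f H = y" by (simp add: f_def mult uu vec_eq_iff)
    ultimately show "y \<in> f ` ?S" by blast
  qed
  then have "dim {y :: real^'n^'g. \<forall>j. \<forall>b\<in>B. y $ j \<bullet> b = 0} \<le> dim (f ` ?S)"
    by (rule dim_subset)
  then show ?thesis
    using dim_kernel_on[OF lin subspace_sym_annihilator[of B], unfolded ker]
      dim_orthogonal_components_ge[OF assms(1), where 'g = 'g]
    by linarith
qed

text \<open>An orthonormal basis of the span is inserted vector by vector. A vector added to
  \<open>i\<close> earlier ones lowers the dimension by at least
  \<open>CARD('g) * (CARD('n) - i)\<close>; the additive form avoids subtracting naturals.\<close>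

lemma dim_sym_annihilator:
  fixes U :: "(real^'n) set"
  assumes "independent U"
  shows "dim (sym_annihilator U :: (real^'n^'n^'g) set) + CARD('g) * card U * CARD('n)
    \<le> dim (sym_tuples :: (real^'n^'n^'g) set) + CARD('g) * (\<Sum>i<card U. i)"
proof -
  obtain B where B: "pairwise orthogonal B" "\<And>b. b \<in> B \<Longrightarrow> norm b = 1"
      "independent B" "card B = dim U" "span B = span U"
    by (metis dim_span orthonormal_basis_subspace subspace_span)
  have "finite B" using B(3) independent_imp_finite by blast
  then have "dim (sym_annihilator B :: (real^'n^'n^'g) set) + CARD('g) * card B * CARD('n)
    \<le> dim (sym_tuples :: (real^'n^'n^'g) set) + CARD('g) * (\<Sum>i<card B. i)"
    using B(1,2)
  proof (induction B rule: finite_induct)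
    case empty
    then show ?case by (simp add: sym_annihilator_def)
  next
    case (insert u B)
    have "u \<bullet> b = 0" if "b \<in> B" for b
      using insert.prems(1) insert.hyps(2) that by (auto simp: pairwise_def orthogonal_def)
    then have "dim (sym_annihilator (insert u B) :: (real^'n^'n^'g) set) + CARD('g) * CARD('n)
      \<le> dim (sym_annihilator B :: (real^'n^'n^'g) set) + CARD('g) * card B"
      using insert by (intro dim_sym_annihilator_insert) auto
    moreover have "dim (sym_annihilator B :: (real^'n^'n^'g) set) + CARD('g) * card B * CARD('n)
      \<le> dim (sym_tuples :: (real^'n^'n^'g) set) + CARD('g) * (\<Sum>i<card B. i)"
      using insert by (auto simp: pairwise_insert)
    ultimately show ?case using insert.hyps by (simp add: algebra_simps)
  qed
  moreover have "card B = card U" using B(4) assms by (simp add: dim_eq_card_independent)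
  moreover have "sym_annihilator B = (sym_annihilator U :: (real^'n^'n^'g) set)"
    using B(5) sym_annihilator_span by metis
  ultimately show ?thesis by simp
qed

section \<open>Diagonalization of symmetric forms\<close>

text \<open>The rows \<open>e i\<close> are the linear forms of a diagonalization, and the \<open>t i\<close> a dual basis of them.\<close>

definition diagonalizable_on :: "'y set \<Rightarrow> ('y \<Rightarrow> 'y \<Rightarrow> real) \<Rightarrow> bool" where
  "diagonalizable_on Y A \<longleftrightarrow>
    (\<exists>t e lam. (\<forall>y\<in>Y. \<forall>z\<in>Y. (\<Sum>i\<in>Y. t i z * e i y) = (if y = z then 1 else 0)) \<and>
      (\<forall>y\<in>Y. \<forall>z\<in>Y. A y z = (\<Sum>i\<in>Y. lam i * e i y * e i z)))"

text \<open>Completing the square with pivot \<open>a\<close>: the form assumed diagonalizable is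
  the Schur complement of \<open>A a a\<close>, whose formula gives 0 as soon as one index is
  \<open>a\<close>.\<close>

lemma diagonalizable_on_insert:
  fixes A :: "'y \<Rightarrow> 'y \<Rightarrow> real"
  assumes fin: "finite Y" and a: "a \<notin> Y" and aa: "A a a \<noteq> 0"
    and sym: "\<And>y z. y \<in> insert a Y \<Longrightarrow> z \<in> insert a Y \<Longrightarrow> A y z = A z y"
    and diag: "diagonalizable_on Y (\<lambda>y z. A y z - A a y * A a z / A a a)"
  shows "diagonalizable_on (insert a Y) A"
proof -
  obtain t e lam where
    t: "\<And>y z. y \<in> Y \<Longrightarrow> z \<in> Y \<Longrightarrow> (\<Sum>i\<in>Y. t i z * e i y) = (if y = z then 1 else 0)"
    and e: "\<And>y z. y \<in> Y \<Longrightarrow> z \<in> Y \<Longrightarrow> A y z - A a y * A a z / A a a = (\<Sum>i\<in>Y. lam i * e i y * e i z)"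
    using diag unfolding diagonalizable_on_def by blast
  define e' where "e' i y = (if i = a then A a y / A a a else if y = a then 0 else e i y)" for i y
  \<comment> \<open>The entries at \<open>z = a\<close> are forced by duality: they cancel the
    contribution of the new row \<open>e' a\<close>.\<close>
  define t' where "t' i z = (if i = a then (if z = a then 1 else 0)
     else if z = a then - (\<Sum>w\<in>Y. t i w * (A a w / A a a)) else t i z)" for i z
  define lam' where "lam' i = (if i = a then A a a else lam i)" for i
  have na: "i \<noteq> a" if "i \<in> Y" for i using that a by auto
  have T: "(\<Sum>i\<in>insert a Y. t' i z * e' i y) = (if y = z then 1 else 0)"
    if yz: "y \<in> insert a Y" "z \<in> insert a Y" for y z
  proof -
    have split: "(\<Sum>i\<in>insert a Y. t' i z * e' i y) = t' a z * e' a y + (\<Sum>i\<in>Y. t' i z * e' i y)"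
      using fin a by simp
    consider "y = a" | "y \<in> Y" "z \<in> Y" | "y \<in> Y" "z = a" using yz by auto
    then show ?thesis
    proof cases
      case 1
      have "(\<Sum>i\<in>Y. t' i z * e' i y) = 0"
        using 1 na by (intro sum.neutral) (auto simp: e'_def)
      then show ?thesis unfolding split using 1 aa by (auto simp: t'_def e'_def)
    next
      case 2
      have "(\<Sum>i\<in>Y. t' i z * e' i y) = (\<Sum>i\<in>Y. t i z * e i y)"
        using 2 na by (intro sum.cong) (auto simp: e'_def t'_def)
      then show ?thesis unfolding split using 2 t na by (auto simp: t'_def)
    next
      case 3
      have "(\<Sum>i\<in>Y. t' i z * e' i y) = (\<Sum>i\<in>Y. \<Sum>w\<in>Y. - (A a w / A a a) * (t i w * e i y))"
        using 3 na by (intro sum.cong) (auto simp: e'_def t'_def sum_distrib_left sum_distrib_right sum_negf[symmetric] mult_ac)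
      also have "\<dots> = (\<Sum>w\<in>Y. - (A a w / A a a) * (\<Sum>i\<in>Y. t i w * e i y))"
        by (subst sum.swap) (simp only: sum_distrib_left)
      also have "\<dots> = (\<Sum>w\<in>Y. - (A a w / A a a) * (if y = w then 1 else 0))"
        using 3 t by (intro sum.cong) auto
      also have "\<dots> = - (A a y / A a a)"
        using 3 fin by (simp add: if_distrib[of "\<lambda>x. _ * x"] sum.delta' cong: if_cong)
      finally show ?thesis unfolding split using 3 a by (auto simp: t'_def e'_def)
    qed
  qed
  have E: "A y z = (\<Sum>i\<in>insert a Y. lam' i * e' i y * e' i z)"
    if yz: "y \<in> insert a Y" "z \<in> insert a Y" for y z
  proof -
    have split: "(\<Sum>i\<in>insert a Y. lam' i * e' i y * e' i z)
        = A a y * A a z / A a a + (\<Sum>i\<in>Y. lam' i * e' i y * e' i z)"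
      using fin a aa by (simp add: lam'_def e'_def)
    show ?thesis
    proof (cases "y = a \<or> z = a")
      case True
      then have "(\<Sum>i\<in>Y. lam' i * e' i y * e' i z) = 0"
        using na by (intro sum.neutral) (auto simp: e'_def)
      then show ?thesis unfolding split using True aa sym[OF yz] by auto
    next
      case False
      then have "(\<Sum>i\<in>Y. lam' i * e' i y * e' i z) = (\<Sum>i\<in>Y. lam i * e i y * e i z)"
        using na by (intro sum.cong) (auto simp: e'_def lam'_def)
      then show ?thesis unfolding split using False yz e[of y z] by auto
    qed
  qed
  show ?thesis unfolding diagonalizable_on_def using T E by blast
qed

text \<open>A quadratic form with zero diagonal gets a nonzero diagonal entry from the
  base change that replaces the basis vector \<open>a\<close> by the sum of \<open>a\<close> and \<open>b\<close>.\<close>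

lemma diagonalizable_on_base_change:
  fixes A :: "'y \<Rightarrow> 'y \<Rightarrow> real"
  assumes ab: "a \<noteq> b" "a \<in> Y" "b \<in> Y" and "finite Y"
    and diag: "diagonalizable_on Y (\<lambda>y z. A y z + (if y = a then A b z else 0)
       + (if z = a then A y b else 0) + (if y = a \<and> z = a then A b b else 0))"
  shows "diagonalizable_on Y A"
proof -
  define B where "B = (\<lambda>y z. A y z + (if y = a then A b z else 0)
       + (if z = a then A y b else 0) + (if y = a \<and> z = a then A b b else 0))"
  obtain t e lam where
    t: "\<And>y z. y \<in> Y \<Longrightarrow> z \<in> Y \<Longrightarrow> (\<Sum>i\<in>Y. t i z * e i y) = (if y = z then 1 else 0)"
    and e: "\<And>y z. y \<in> Y \<Longrightarrow> z \<in> Y \<Longrightarrow> B y z = (\<Sum>i\<in>Y. lam i * e i y * e i z)"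
    using diag unfolding diagonalizable_on_def B_def by blast
  \<comment> \<open>\<open>B\<close> is \<open>A\<close> after \<open>a\<close> becomes
    \<open>a + b\<close>. Writing the old \<open>a\<close> as the new one minus \<open>b\<close>
    gives \<open>e'\<close>; \<open>t'\<close> is the dual change.\<close>
  define e' where "e' i y = e i y - (if y = a then e i b else 0)" for i y
  define t' where "t' i z = t i z + (if z = b then t i a else 0)" for i z
  have "(\<Sum>i\<in>Y. t' i z * e' i y) = (if y = z then 1 else 0)" if yz: "y \<in> Y" "z \<in> Y" for y z
  proof -
    have "(\<Sum>i\<in>Y. t' i z * e' i y) = (\<Sum>i\<in>Y. t i z * e i y)
       - (if y = a then \<Sum>i\<in>Y. t i z * e i b else 0) + (if z = b then \<Sum>i\<in>Y. t i a * e i y else 0)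
       - (if y = a \<and> z = b then \<Sum>i\<in>Y. t i a * e i b else 0)"
      by (auto simp: t'_def e'_def algebra_simps sum.distrib sum_subtractf)
    then show ?thesis using yz ab t by auto
  qed
  moreover have "A y z = (\<Sum>i\<in>Y. lam i * e' i y * e' i z)" if yz: "y \<in> Y" "z \<in> Y" for y z
  proof -
    have "A y z = B y z - (if y = a then B b z else 0) - (if z = a then B y b else 0)
        + (if y = a \<and> z = a then B b b else 0)"
      using ab by (auto simp: B_def)
    also have "\<dots> = (\<Sum>i\<in>Y. lam i * e' i y * e' i z)"
      using yz ab e by (auto simp: e'_def algebra_simps sum.distrib sum_subtractf)
    finally show ?thesis .
  qed
  ultimately show ?thesis unfolding diagonalizable_on_def by blast
qed

text \<open>Lagrange reduction by induction on the number of indices: split off a nonzero diagonal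
  entry, create one from a nonzero off-diagonal entry, or take the identity for the zero
  form.\<close>

lemma symmetric_diagonalizable_on:
  fixes A :: "'y \<Rightarrow> 'y \<Rightarrow> real"
  assumes "finite Y" "\<And>y z. y \<in> Y \<Longrightarrow> z \<in> Y \<Longrightarrow> A y z = A z y"
  shows "diagonalizable_on Y A"
  using assms
proof (induction "card Y" arbitrary: Y A)
  case 0
  then show ?case by (simp add: diagonalizable_on_def)
next
  case (Suc n)
  have step: "diagonalizable_on Y B"
    if sym: "\<And>y z. y \<in> Y \<Longrightarrow> z \<in> Y \<Longrightarrow> B y z = B z y" and a: "a \<in> Y" "B a a \<noteq> 0"
    for B :: "'y \<Rightarrow> 'y \<Rightarrow> real" and a
  proof -
    have Y: "insert a (Y - {a}) = Y" using a by auto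
    have "diagonalizable_on (Y - {a}) (\<lambda>y z. B y z - B a y * B a z / B a a)"
      using Suc.hyps Suc.prems(1) a(1) sym by (intro Suc.hyps(1)) auto
    then have "diagonalizable_on (insert a (Y - {a})) B"
      using Suc.prems(1) a sym by (intro diagonalizable_on_insert) auto
    then show ?thesis using Y by simp
  qed
  consider (diag) a where "a \<in> Y" "A a a \<noteq> 0"
    | (offdiag) a b where "a \<in> Y" "b \<in> Y" "A a b \<noteq> 0" "A a a = 0" "A b b = 0"
    | (zero) "\<And>y z. y \<in> Y \<Longrightarrow> z \<in> Y \<Longrightarrow> A y z = 0"
    by metis
  then show ?case
  proof cases
    case diag
    then show ?thesis using step[of A a] Suc.prems by blast
  next
    case offdiag
    then have "a \<noteq> b" by auto
    have "A b a = A a b" using offdiag Suc.prems by auto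
    \<comment> \<open>The new entry at \<open>(a, a)\<close> is \<open>2 * A a b\<close>, since both
      old diagonal entries vanish and \<open>A\<close> is symmetric.\<close>
    have base: "diagonalizable_on Y (\<lambda>y z. A y z + (if y = a then A b z else 0)
       + (if z = a then A y b else 0) + (if y = a \<and> z = a then A b b else 0))"
    proof (rule step[of _ a])
      fix y z assume "y \<in> Y" "z \<in> Y"
      then show "A y z + (if y = a then A b z else 0) + (if z = a then A y b else 0)
          + (if y = a \<and> z = a then A b b else 0)
        = A z y + (if z = a then A b y else 0) + (if y = a then A z b else 0)
          + (if z = a \<and> y = a then A b b else 0)"
        using Suc.prems(2)[of y z] Suc.prems(2)[of y b] Suc.prems(2)[of z b] offdiag by simp
    qed (use offdiag \<open>A b a = A a b\<close> in auto)
    show ?thesis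
      by (rule diagonalizable_on_base_change[where A = A, OF \<open>a \<noteq> b\<close> offdiag(1,2) Suc.prems(1) base])
  next
    case zero
    define \<delta> :: "'y \<Rightarrow> 'y \<Rightarrow> real" where "\<delta> i y = (if i = y then 1 else 0)" for i y
    have "\<forall>y\<in>Y. \<forall>z\<in>Y. (\<Sum>i\<in>Y. \<delta> i z * \<delta> i y) = (if y = z then 1 else 0)"
    proof (intro ballI)
      fix y z assume "y \<in> Y" "z \<in> Y"
      have "(\<Sum>i\<in>Y. \<delta> i z * \<delta> i y) = (\<Sum>i\<in>Y. if i = z then \<delta> i y else 0)"
        by (intro sum.cong) (auto simp: \<delta>_def)
      then show "(\<Sum>i\<in>Y. \<delta> i z * \<delta> i y) = (if y = z then 1 else 0)"
        using Suc.prems(1) \<open>z \<in> Y\<close> by (auto simp: \<delta>_def)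
    qed
    moreover have "\<forall>y\<in>Y. \<forall>z\<in>Y. A y z = (\<Sum>i\<in>Y. (\<lambda>_. 0) i * \<delta> i y * \<delta> i z)"
      using zero by simp
    ultimately show ?thesis unfolding diagonalizable_on_def by (intro exI conjI)
  qed
qed

section \<open>Evaluation and transposition\<close>

lemma lookup_scaleR [simp]:
  "Poly_Mapping.lookup (c *\<^sub>R p) w = c *\<^sub>R Poly_Mapping.lookup p w"
  by (simp add: scaleR_poly_mapping_def)

lemma poly_mapping_sum_single:
  assumes "finite A" "Poly_Mapping.keys p \<subseteq> A"
  shows "p = (\<Sum>w\<in>A. Poly_Mapping.single w (Poly_Mapping.lookup p w))"
proof (rule poly_mapping_eqI)
  fix w
  show "Poly_Mapping.lookup p w
    = Poly_Mapping.lookup (\<Sum>w\<in>A. Poly_Mapping.single w (Poly_Mapping.lookup p w)) w"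
    using assms by (auto simp: lookup_sum lookup_single when_def sum.delta in_keys_iff)
qed

text \<open>Scaling is left multiplication by a constant polynomial, and constants are central
  because their exponent \<open>0\<close> is neutral.\<close>

instance poly_mapping :: (monoid_add, real_algebra_1) real_algebra_1
proof
  fix c :: real and p q :: "'a \<Rightarrow>\<^sub>0 'b"
  have scale: "c *\<^sub>R r = Poly_Mapping.single 0 (of_real c) * r" for r :: "'a \<Rightarrow>\<^sub>0 'b"
    by (rule poly_mapping_eqI)
      (simp add: mult_map_scale_conv_mult[symmetric] map.rep_eq when_def scaleR_conv_of_real)
  have single: "Poly_Mapping.single w a * Poly_Mapping.single 0 (of_real c)
      = Poly_Mapping.single 0 (of_real c) * Poly_Mapping.single w a" for w :: 'a and a :: 'b
    by (simp add: mult_single of_real_def)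
  have comm: "p * Poly_Mapping.single 0 (of_real c) = Poly_Mapping.single 0 (of_real c) * p"
    by (subst (1 2) poly_mapping_sum_single[OF finite_keys order_refl])
      (simp add: sum_distrib_left sum_distrib_right single)
  show "c *\<^sub>R p * q = c *\<^sub>R (p * q)" by (simp add: scale mult.assoc)
  show "p * c *\<^sub>R q = c *\<^sub>R (p * q)" by (simp add: scale mult.assoc[symmetric] comm)
qed

text \<open>Used to reduce multiplicativity of evaluation and its adjoint rule to single
  words.\<close>

lemma linear_eq_on_monomials:
  fixes f g :: "('w \<Rightarrow>\<^sub>0 real) \<Rightarrow> 'b::real_vector"
  assumes "linear f" "linear g"
    "\<And>w. f (Poly_Mapping.single w 1) = g (Poly_Mapping.single w 1)"
  shows "f p = g p"
proof -
  have single: "Poly_Mapping.single w a = a *\<^sub>R Poly_Mapping.single w 1" for w :: 'w and a :: real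
    by (rule poly_mapping_eqI) (simp add: lookup_single when_def)
  show ?thesis
    by (subst (1 2) poly_mapping_sum_single[OF finite_keys order_refl])
      (simp add: assms linear_sum linear_scale single[of _ "Poly_Mapping.lookup _ _"])
qed

lemma nc_eval_superset:
  assumes "finite A" "Poly_Mapping.keys p \<subseteq> A"
  shows "nc_eval X p = (\<Sum>w\<in>A. Poly_Mapping.lookup p w *\<^sub>R foldr (\<lambda>j M. X j ** M) (letters w) (mat 1))"
  unfolding nc_eval_def using assms
  by (intro sum.mono_neutral_left) (auto simp: in_keys_iff)

lemma linear_nc_eval:
  fixes X :: "'a \<Rightarrow> real^'n^'n"
  shows "linear (nc_eval X)"
proof (rule linearI)
  fix p q :: "'a ncpoly" and c :: real
  let ?A = "Poly_Mapping.keys p \<union> Poly_Mapping.keys q"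
  have A: "finite ?A" by simp
  show "nc_eval X (p + q) = nc_eval X p + nc_eval X q"
    using keys_add[of p q] by (simp add: nc_eval_superset[OF A] lookup_add scaleR_add_left sum.distrib)
  have "Poly_Mapping.keys (c *\<^sub>R p) \<subseteq> Poly_Mapping.keys p" by (auto simp: in_keys_iff)
  then show "nc_eval X (c *\<^sub>R p) = c *\<^sub>R nc_eval X p"
    by (simp add: nc_eval_superset[of "Poly_Mapping.keys p"] scaleR_sum_right)
qed

lemma linear_matrix_vector_mult_left: "linear (\<lambda>M :: real^'n^'m. M *v v)"
  by (rule linearI) (simp_all add: matrix_vector_mult_add_rdistrib scaleR_matrix_vector_assoc)

lemma linear_nc_eval_vec: "linear (\<lambda>p. nc_eval X p *v v)"
  using linear_compose[OF linear_nc_eval linear_matrix_vector_mult_left] by (simp add: o_def)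

lemma nc_eval_monomial:
  "nc_eval X (Poly_Mapping.single w 1) *v v = foldr (\<lambda>j u. X j *v u) (letters w) v"
proof -
  have "foldr (\<lambda>j M. X j ** M) ws (mat 1) *v v = foldr (\<lambda>j u. X j *v u) ws v" for ws
    by (induction ws) (auto simp: matrix_vector_mul_assoc[symmetric])
  then show ?thesis by (simp add: nc_eval_def)
qed

text \<open>Both sides are linear in each factor, so two words suffice; there concatenation becomes
  composition of iterated matrix-vector products.\<close>

lemma nc_eval_mult:
  fixes p q :: "'a ncpoly"
  shows "nc_eval X (p * q) *v v = nc_eval X p *v (nc_eval X q *v v)"
proof (rule linear_eq_on_monomials[where p = p and f = "\<lambda>p. nc_eval X (p * q) *v v"
      and g = "\<lambda>p. nc_eval X p *v (nc_eval X q *v v)"])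
  show "linear (\<lambda>p. nc_eval X (p * q) *v v)"
    by (rule linearI) (simp_all add: distrib_right linear_add[OF linear_nc_eval_vec]
        linear_scale[OF linear_nc_eval_vec])
  show "linear (\<lambda>p. nc_eval X p *v (nc_eval X q *v v))" by (rule linear_nc_eval_vec)
  fix w :: "'a ncword"
  let ?w = "Poly_Mapping.single w (1 :: real)"
  show "nc_eval X (?w * q) *v v = nc_eval X ?w *v (nc_eval X q *v v)"
  proof (rule linear_eq_on_monomials[where p = q and f = "\<lambda>q. nc_eval X (?w * q) *v v"
        and g = "\<lambda>q. nc_eval X ?w *v (nc_eval X q *v v)"])
    show "linear (\<lambda>q. nc_eval X (?w * q) *v v)"
      by (rule linearI) (simp_all add: distrib_left linear_add[OF linear_nc_eval_vec]
        linear_scale[OF linear_nc_eval_vec])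
    show "linear (\<lambda>q. nc_eval X ?w *v (nc_eval X q *v v))"
      using linear_compose[OF linear_nc_eval_vec matrix_vector_mul_linear] by (simp add: o_def)
    fix u
    show "nc_eval X (?w * Poly_Mapping.single u 1) *v v
        = nc_eval X ?w *v (nc_eval X (Poly_Mapping.single u 1) *v v)"
      by (simp add: mult_single nc_eval_monomial plus_ncword_def)
  qed
qed

section \<open>The involution and adjoint operators\<close>

lemma inj_reverse_ncword: "inj (\<lambda>w. NCWord (rev (letters w)))"
  by (rule injI) (metis ncword.collapse ncword.inject rev_rev_ident)

lemma lookup_nc_transpose:
  "Poly_Mapping.lookup (nc_transpose p) w = Poly_Mapping.lookup p (NCWord (rev (letters w)))"
  by (simp add: nc_transpose_def map_key.rep_eq[OF inj_reverse_ncword])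

lemma linear_nc_transpose: "linear nc_transpose"
  by (rule linearI) (auto intro!: poly_mapping_eqI simp: lookup_nc_transpose lookup_add)

lemma nc_transpose_monomial:
  "nc_transpose (Poly_Mapping.single w c) = Poly_Mapping.single (NCWord (rev (letters w))) c"
  by (rule poly_mapping_eqI) (auto simp: lookup_nc_transpose lookup_single when_def)

text \<open>Each symmetric \<open>X j\<close> is self-adjoint, so reversing a word gives the adjoint
  of its product.\<close>

lemma nc_eval_transpose:
  assumes "\<And>j. transpose (X j) = X j"
  shows "(nc_eval X (nc_transpose p) *v u) \<bullet> v = u \<bullet> (nc_eval X p *v v)"
proof (rule linear_eq_on_monomials[where p = p and f = "\<lambda>p. (nc_eval X (nc_transpose p) *v u) \<bullet> v"
      and g = "\<lambda>p. u \<bullet> (nc_eval X p *v v)"])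
  show "linear (\<lambda>p. (nc_eval X (nc_transpose p) *v u) \<bullet> v)"
    by (rule linearI) (simp_all add: linear_add[OF linear_nc_transpose] linear_scale[OF linear_nc_transpose]
        linear_add[OF linear_nc_eval_vec] linear_scale[OF linear_nc_eval_vec] inner_add_left)
  show "linear (\<lambda>p. u \<bullet> (nc_eval X p *v v))"
    by (rule linearI) (simp_all add: 
        linear_add[OF linear_nc_eval_vec] linear_scale[OF linear_nc_eval_vec] inner_add_right)
  fix w
  have adj: "(X j *v u) \<bullet> v = u \<bullet> (X j *v v)" for j u v
    using assms[of j] by (metis dot_lmul_matrix transpose_matrix_vector)
  have "foldr (\<lambda>j u. X j *v u) (rev ws) u \<bullet> v = u \<bullet> foldr (\<lambda>j u. X j *v u) ws v" for ws
    by (induction ws arbitrary: u) (auto simp: adj)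
  then show "(nc_eval X (nc_transpose (Poly_Mapping.single w 1)) *v u) \<bullet> v
      = u \<bullet> (nc_eval X (Poly_Mapping.single w 1) *v v)"
    by (simp add: nc_transpose_monomial nc_eval_monomial)
qed

section \<open>The Hessian with a constant middle matrix\<close>

lemma vector_derivative_sum_power:
  fixes c :: "'i \<Rightarrow> 'b::real_normed_vector"
  shows "vector_derivative (\<lambda>s. \<Sum>i\<in>I. (a i * s ^ n i) *\<^sub>R c i) (at t)
    = (\<Sum>i\<in>I. (a i * real (n i) * t ^ (n i - 1)) *\<^sub>R c i)"
proof (rule vector_derivative_at)
  have "((\<lambda>s. (a i * s ^ n i) *\<^sub>R c i) has_vector_derivative (a i * real (n i) * t ^ (n i - 1)) *\<^sub>R c i) (at t)" for i
    using has_vector_derivative_scaleR[OF _ has_vector_derivative_const[of "c i"],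
        of "\<lambda>s. a i * s ^ n i" "a i * real (n i) * t ^ (n i - 1)" t UNIV]
    by (auto intro!: derivative_eq_intros simp: mult_ac)
  then show "((\<lambda>s. \<Sum>i\<in>I. (a i * s ^ n i) *\<^sub>R c i) has_vector_derivative
      (\<Sum>i\<in>I. (a i * real (n i) * t ^ (n i - 1)) *\<^sub>R c i)) (at t)"
    by (intro has_vector_derivative_sum)
qed

lemma second_vector_derivative_sum_power:
  fixes c :: "'i \<Rightarrow> 'b::real_normed_vector"
  assumes "finite I"
  shows "vector_derivative (\<lambda>t. vector_derivative (\<lambda>s. \<Sum>i\<in>I. (a i * s ^ n i) *\<^sub>R c i) (at t)) (at 0)
    = (\<Sum>i\<in>{i \<in> I. n i = 2}. (2 * a i) *\<^sub>R c i)"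
proof -
  have "vector_derivative (\<lambda>t. vector_derivative (\<lambda>s. \<Sum>i\<in>I. (a i * s ^ n i) *\<^sub>R c i) (at t)) (at 0)
    = (\<Sum>i\<in>I. (a i * real (n i) * real (n i - 1) * 0 ^ (n i - 1 - 1)) *\<^sub>R c i)"
    by (simp only: vector_derivative_sum_power)
  also have "\<dots> = (\<Sum>i\<in>{i \<in> I. n i = 2}. (2 * a i) *\<^sub>R c i)"
  proof (rule sum.mono_neutral_cong_right)
    \<comment> \<open>Truncated subtraction is harmless: for \<open>n i < 2\<close> one of the first
      two factors vanishes, and for \<open>n i > 2\<close> the power of 0 does. At
      \<open>n i = 2\<close> the convention \<open>0 ^ 0 = 1\<close> leaves the factor 2.\<close>
    have "n i \<noteq> 2 \<Longrightarrow> real (n i) * real (n i - 1) * 0 ^ (n i - 1 - 1) = 0" for i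
      by (cases "n i < 2") (auto simp: less_2_cases_iff)
    then show "\<forall>i\<in>I - {i \<in> I. n i = 2}. (a i * real (n i) * real (n i - 1) * 0 ^ (n i - 1 - 1)) *\<^sub>R c i = 0"
      by (auto simp: mult.assoc)
  qed (use assms in auto)
  finally show ?thesis .
qed

section \<open>Words with marked positions and the expansion of the Hessian\<close>

definition mark :: "nat set \<Rightarrow> 'a list \<Rightarrow> ('a + 'a) ncword" where
  "mark S ws = NCWord (map (\<lambda>i. if i \<in> S then Inr (ws ! i) else Inl (ws ! i)) [0..<length ws])"

abbreviation monomial :: "'w \<Rightarrow> 'w \<Rightarrow>\<^sub>0 real" where
  "monomial w \<equiv> Poly_Mapping.single w 1"

text \<open>\<open>mark\<close> ignores positions beyond the word, so \<open>S\<close> must be cut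
  off at \<open>length us\<close> before the shifted \<open>T\<close> is joined to it.\<close>

lemma mark_append:
  "mark S us + mark T zs = mark ({i \<in> S. i < length us} \<union> (+) (length us) ` T) (us @ zs)"
proof -
  have "i \<in> (+) (length us) ` T \<longleftrightarrow> length us \<le> i \<and> i - length us \<in> T" for i
    by (metis image_iff le_add1 add_diff_cancel_left' le_add_diff_inverse)
  then show ?thesis
    by (auto simp: mark_def plus_ncword_def nth_append intro!: nth_equalityI)
qed

lemma mark_snoc:
  assumes "S \<subseteq> {..<length ws}"
  shows "mark S (ws @ [j]) = mark S ws + NCWord [Inl j]"
    "mark (insert (length ws) S) (ws @ [j]) = mark S ws + NCWord [Inr j]"
  using assms by (auto simp: mark_def plus_ncword_def nth_append)

lemma mark_reverse:
  assumes "r < length ws"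
  shows "NCWord (rev (letters (mark {r} ws))) = mark {length ws - 1 - r} (rev ws)"
  using assms by (auto simp: mark_def rev_nth intro!: nth_equalityI)

text \<open>Expanding the product picks \<open>x\<close> or \<open>s h\<close> from each factor;
  \<open>S\<close> records the factors that supply an \<open>h\<close>.\<close>

lemma prod_list_perturbation:
  "prod_list (map (\<lambda>j. nc_var (Inl j) + s *\<^sub>R nc_var (Inr j)) ws)
    = (\<Sum>S\<in>Pow {..<length ws}. s ^ card S *\<^sub>R monomial (mark S ws))"
proof (induction ws rule: rev_induct)
  case Nil
  then show ?case by (simp add: mark_def flip: zero_ncword_def)
next
  case (snoc j ws)
  let ?P = "Pow {..<length ws}" and ?N = "length ws"
  have fin: "finite S" if "S \<in> ?P" for S using that finite_subset by auto
  have inj: "inj_on (insert ?N) ?P" by (rule inj_on_inverseI[where g = "\<lambda>S. S - {?N}"]) auto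
  have Pow: "Pow {..<length (ws @ [j])} = ?P \<union> insert ?N ` ?P"
    by (simp add: lessThan_Suc Pow_insert)
  have "(\<Sum>S\<in>Pow {..<length (ws @ [j])}. s ^ card S *\<^sub>R monomial (mark S (ws @ [j])))
    = (\<Sum>S\<in>?P. s ^ card S *\<^sub>R monomial (mark S (ws @ [j])))
      + (\<Sum>S\<in>?P. s ^ card (insert ?N S) *\<^sub>R monomial (mark (insert ?N S) (ws @ [j])))"
    unfolding Pow by (subst sum.union_disjoint) (auto simp: sum.reindex[OF inj])
  also have "\<dots> = (\<Sum>S\<in>?P. s ^ card S *\<^sub>R (monomial (mark S ws) * nc_var (Inl j)))
      + (\<Sum>S\<in>?P. s ^ card S *\<^sub>R (monomial (mark S ws) * (s *\<^sub>R nc_var (Inr j))))"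
    by (intro arg_cong2[where f = "(+)"] sum.cong refl)
      (auto simp: mark_snoc nc_var_def mult_single card_insert_if fin)
  also have "\<dots> = prod_list (map (\<lambda>j. nc_var (Inl j) + s *\<^sub>R nc_var (Inr j)) (ws @ [j]))"
    by (simp add: snoc.IH distrib_left sum_distrib_right scaleR_sum_right mult.commute)
  finally show ?case by simp
qed

lemma nc_hessian_expansion:
  "nc_hessian p = (\<Sum>w\<in>Poly_Mapping.keys p. (2 * Poly_Mapping.lookup p w) *\<^sub>R
      (\<Sum>S\<in>{S. S \<subseteq> {..<length (letters w)} \<and> card S = 2}. monomial (mark S (letters w))))"
proof -
  let ?I = "Sigma (Poly_Mapping.keys p) (\<lambda>w. Pow {..<length (letters w)})"
  have subst: "nc_subst (\<lambda>j. nc_var (Inl j) + s *\<^sub>R nc_var (Inr j)) p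
     = (\<Sum>i\<in>?I. (Poly_Mapping.lookup p (fst i) * s ^ card (snd i)) *\<^sub>R monomial (mark (snd i) (letters (fst i))))" for s
    by (simp add: nc_subst_def prod_list_perturbation sum.Sigma scaleR_sum_right case_prod_beta)
  have "nc_hessian p = (\<Sum>i\<in>{i \<in> ?I. card (snd i) = 2}.
      (2 * Poly_Mapping.lookup p (fst i)) *\<^sub>R monomial (mark (snd i) (letters (fst i))))"
    unfolding nc_hessian_def subst by (rule second_vector_derivative_sum_power) auto
  moreover have "{i \<in> ?I. card (snd i) = 2}
      = Sigma (Poly_Mapping.keys p) (\<lambda>w. {S. S \<subseteq> {..<length (letters w)} \<and> card S = 2})"
    by auto
  moreover have "finite {S. S \<subseteq> {..<length (letters w)} \<and> card S = 2}" for w :: "'a ncword"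
    by (rule finite_subset[of _ "Pow {..<length (letters w)}"]) auto
  ultimately show ?thesis
    by (simp add: sum.Sigma case_prod_beta scaleR_sum_right)
qed

text \<open>The Taylor coefficients of \<open>(1 - t)\<close> to the power \<open>-1/2\<close>.\<close>

definition isqrt_coeff :: "nat \<Rightarrow> real" where
  "isqrt_coeff r = (-1) ^ r * ((-1/2) gchoose r)"

lemma isqrt_coeff_0 [simp]: "isqrt_coeff 0 = 1"
  by (simp add: isqrt_coeff_def)

text \<open>The square of the series is the geometric series of \<open>1 / (1 - t)\<close>; on
  coefficients this is Vandermonde's identity for the exponents -1/2 and -1/2.\<close>

lemma isqrt_coeff_convolution: "(\<Sum>k\<le>n. isqrt_coeff k * isqrt_coeff (n - k)) = 1"
proof -
  have "(\<Sum>k\<le>n. isqrt_coeff k * isqrt_coeff (n - k))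
      = (-1) ^ n * (\<Sum>k\<le>n. ((-1/2) gchoose k) * ((-1/2) gchoose (n - k)))"
    unfolding sum_distrib_left
    by (intro sum.cong refl) (simp add: isqrt_coeff_def power_add[symmetric] mult.assoc mult.left_commute)
  also have "(\<Sum>k\<le>n. ((-1/2) gchoose k) * ((-1/2) gchoose (n - k))) = ((-1) gchoose n :: real)"
    using gbinomial_Vandermonde[of "-1/2 :: real" "-1/2" n] by (simp add: atLeast0AtMost)
  also have "\<dots> = (-1) ^ n"
    using gbinomial_minus[of "1 :: real" n] by (simp add: binomial_gbinomial[symmetric] del: of_nat_add)
  finally show ?thesis by (simp add: power_add[symmetric])
qed

text \<open>The polynomial \<open>W\<^sub>y\<close> of the overview.\<close>

definition border :: "'a list \<Rightarrow> ('a + 'a) ncpoly" where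
  "border y = (\<Sum>r<length y. isqrt_coeff r *\<^sub>R monomial (mark {r} y))"

text \<open>Reversal makes the weight depend on the distance from the right end of
  \<open>us\<close>. In both factors of a splitting it is thus the distance of the \<open>h\<close>
  from the cut that counts.\<close>

lemma nc_transpose_border_rev:
  "nc_transpose (border (rev us)) = (\<Sum>i<length us. isqrt_coeff (length us - 1 - i) *\<^sub>R monomial (mark {i} us))"
proof -
  have "nc_transpose (border (rev us))
      = (\<Sum>r<length us. isqrt_coeff r *\<^sub>R monomial (mark {length us - 1 - r} us))"
    by (simp add: border_def linear_sum[OF linear_nc_transpose] linear_scale[OF linear_nc_transpose]
        nc_transpose_monomial mark_reverse cong: sum.cong_simp)
  also have "\<dots> = (\<Sum>i<length us. isqrt_coeff (length us - 1 - i) *\<^sub>R monomial (mark {i} us))"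
    by (rule sum.reindex_bij_witness[of _ "\<lambda>i. length us - 1 - i" "\<lambda>i. length us - 1 - i"]) auto
  finally show ?thesis .
qed

lemma border_split_product:
  "nc_transpose (border (rev us)) * border zs
    = (\<Sum>i<length us. \<Sum>r<length zs. (isqrt_coeff (length us - 1 - i) * isqrt_coeff r) *\<^sub>R
        monomial (mark {i, length us + r} (us @ zs)))"
  unfolding nc_transpose_border_rev unfolding border_def sum_product
proof (intro sum.cong refl)
  fix i r assume "i \<in> {..<length us}"
  then have "{k \<in> {i}. k < length us} \<union> (+) (length us) ` {r} = {i, length us + r}" by auto
  then have "mark {i} us + mark {r} zs = mark {i, length us + r} (us @ zs)"
    by (simp only: mark_append)
  then show "isqrt_coeff (length us - 1 - i) *\<^sub>R monomial (mark {i} us) * isqrt_coeff r *\<^sub>R monomial (mark {r} zs)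
      = (isqrt_coeff (length us - 1 - i) * isqrt_coeff r) *\<^sub>R monomial (mark {i, length us + r} (us @ zs))"
    by (simp add: mult_single)
qed

text \<open>A cut \<open>l\<close> contributes to the marks \<open>i < j\<close> exactly when
  \<open>i < l \<le> j\<close>. With \<open>k = l - 1 - i\<close> its weight is
  \<open>isqrt_coeff k * isqrt_coeff (j - 1 - i - k)\<close>, and these weights sum to 1 over
  \<open>k \<le> j - 1 - i\<close>.\<close>

lemma sum_border_split_products:
  "(\<Sum>l\<in>{0<..<length ws}. nc_transpose (border (rev (take l ws))) * border (drop l ws))
    = (\<Sum>S\<in>{S. S \<subseteq> {..<length ws} \<and> card S = 2}. monomial (mark S ws))"
proof -
  let ?N = "length ws"
  let ?m = "\<lambda>i j. monomial (mark {i, j} ws)"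
  let ?L = "Sigma {0<..<?N} (\<lambda>l. {..<l} \<times> {..<?N - l})"
  let ?R = "Sigma (Sigma {..<?N} (\<lambda>j. {..<j})) (\<lambda>(j, i). {..j - 1 - i})"
  have "(\<Sum>l\<in>{0<..<?N}. nc_transpose (border (rev (take l ws))) * border (drop l ws))
    = (\<Sum>l\<in>{0<..<?N}. \<Sum>i<l. \<Sum>r<?N - l. (isqrt_coeff (l - 1 - i) * isqrt_coeff r) *\<^sub>R ?m i (l + r))"
    by (intro sum.cong refl) (simp add: border_split_product min_def)
  also have "\<dots> = (\<Sum>(l, i, r)\<in>?L. (isqrt_coeff (l - 1 - i) * isqrt_coeff r) *\<^sub>R ?m i (l + r))"
    by (simp add: sum.Sigma)
  also have "\<dots> = (\<Sum>((j, i), k)\<in>?R. (isqrt_coeff k * isqrt_coeff (j - 1 - i - k)) *\<^sub>R ?m i j)"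
    by (rule sum.reindex_bij_witness[of _ "\<lambda>((j, i), k). (k + 1 + i, i, j - 1 - i - k)"
        "\<lambda>(l, i, r). ((l + r, i), l - 1 - i)"]) auto
  also have "\<dots> = (\<Sum>(j, i)\<in>Sigma {..<?N} (\<lambda>j. {..<j}). \<Sum>k\<le>j - 1 - i. (isqrt_coeff k * isqrt_coeff (j - 1 - i - k)) *\<^sub>R ?m i j)"
    by (subst sum.Sigma[symmetric]) (auto simp: case_prod_beta)
  also have "\<dots> = (\<Sum>(j, i)\<in>Sigma {..<?N} (\<lambda>j. {..<j}). ?m i j)"
    by (intro sum.cong refl) (auto simp: scaleR_sum_left[symmetric] isqrt_coeff_convolution simp del: diff_diff_left)
  also have "\<dots> = (\<Sum>S\<in>{S. S \<subseteq> {..<?N} \<and> card S = 2}. monomial (mark S ws))"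
  proof (rule sum.reindex_bij_witness[of _ "\<lambda>S. (Max S, Min S)" "\<lambda>(j, i). {i, j}"])
    fix S :: "nat set" assume "S \<in> {S. S \<subseteq> {..<?N} \<and> card S = 2}"
    then obtain a b where S: "S = {a, b}" "a < b" "b < ?N"
      by (auto simp: card_2_iff) (metis doubleton_eq_iff linorder_neqE_nat)
    then show "(case (Max S, Min S) of (j, i) \<Rightarrow> {i, j}) = S"
      "(Max S, Min S) \<in> Sigma {..<?N} (\<lambda>j. {..<j})" by auto
  qed auto
  finally show ?thesis .
qed

section \<open>The Hessian as a quadratic form in the border polynomials\<close>

definition border_words :: "nat \<Rightarrow> 'a list set" where
  "border_words d = {y. y \<noteq> [] \<and> length y < d}"

lemma finite_border_words [simp]: "finite (border_words d :: 'a::finite list set)"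
  using finite_lists_length_le[of "UNIV :: 'a set" d]
  by (rule finite_subset[rotated]) (auto simp: border_words_def)

definition middle :: "'a ncpoly \<Rightarrow> 'a list \<Rightarrow> 'a list \<Rightarrow> real" where
  "middle p y z = 2 * Poly_Mapping.lookup p (NCWord (rev y @ z))"

lemma length_le_nc_degree:
  assumes "w \<in> Poly_Mapping.keys p"
  shows "length (letters w) \<le> nc_degree p"
  using assms by (simp add: nc_degree_def)

text \<open>A pair \<open>(y, z)\<close> amounts to the word \<open>rev y @ z\<close> with its cut
  at \<open>length y\<close>. Both parts are nonempty, so the degree bound makes them shorter than
  \<open>d\<close>; words outside the support have coefficient 0.\<close>

lemma nc_hessian_border:
  fixes p :: "'a::finite ncpoly"
  assumes "nc_degree p = d"
  shows "nc_hessian p = (\<Sum>y\<in>border_words d. \<Sum>z\<in>border_words d.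
    middle p y z *\<^sub>R (nc_transpose (border y) * border z))"
proof -
  let ?F = "\<lambda>y z. middle p y z *\<^sub>R (nc_transpose (border y) * border z)"
  let ?K = "Poly_Mapping.keys p"
  let ?I = "{(y, z). y \<in> border_words d \<and> z \<in> border_words d \<and> NCWord (rev y @ z) \<in> ?K}"
  let ?J = "Sigma ?K (\<lambda>w. {0<..<length (letters w)})"
  have "(\<Sum>y\<in>border_words d. \<Sum>z\<in>border_words d. ?F y z)
      = (\<Sum>(y, z)\<in>border_words d \<times> border_words d. ?F y z)"
    by (rule sum.cartesian_product)
  also have "\<dots> = (\<Sum>(y, z)\<in>?I. ?F y z)"
    by (rule sum.mono_neutral_right) (auto simp: middle_def in_keys_iff)
  also have "\<dots> = (\<Sum>(w, l)\<in>?J. (2 * Poly_Mapping.lookup p w) *\<^sub>R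
      (nc_transpose (border (rev (take l (letters w)))) * border (drop l (letters w))))"
  proof (rule sum.reindex_bij_witness[of _ "\<lambda>(w, l). (rev (take l (letters w)), drop l (letters w))"
        "\<lambda>(y, z). (NCWord (rev y @ z), length y)"], goal_cases)
    case (4 b)
    then show ?case
      using length_le_nc_degree[of "fst b" p] assms by (auto simp: border_words_def)
  qed (auto simp: border_words_def middle_def)
  also have "\<dots> = nc_hessian p"
    by (simp add: nc_hessian_expansion sum.Sigma[symmetric] scaleR_sum_right[symmetric]
        sum_border_split_products)
  finally show ?thesis by simp
qed

section \<open>Negative squares\<close>

text \<open>Absorbing the square root of \<open>\<bar>lam i\<bar>\<close> into \<open>q i\<close>
  yields a genuine difference of squares, which bounds the minimum from above.\<close>

lemma sigma_minus_min_le: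
  fixes q :: "'i \<Rightarrow> 'a ncpoly"
  assumes "finite Y" "f = (\<Sum>i\<in>Y. lam i *\<^sub>R (nc_transpose (q i) * q i))"
  shows "sigma_minus_min f \<le> card {i \<in> Y. lam i < 0}"
proof -
  let ?P = "{i \<in> Y. lam i \<ge> 0}" and ?M = "{i \<in> Y. lam i < 0}"
  define r where "r i = sqrt \<bar>lam i\<bar> *\<^sub>R q i" for i
  have r: "nc_transpose (r i) * r i = \<bar>lam i\<bar> *\<^sub>R (nc_transpose (q i) * q i)" for i
    by (simp add: r_def linear_scale[OF linear_nc_transpose])
  have "finite ?P" "finite ?M" using assms(1) by auto
  then obtain ps ms where ps: "set ps = ?P" "distinct ps" and ms: "set ms = ?M" "distinct ms"
    using finite_distinct_list by meson
  have "f = (\<Sum>i\<in>?P \<union> ?M. lam i *\<^sub>R (nc_transpose (q i) * q i))"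
    unfolding assms(2) by (rule sum.cong) auto
  also have "\<dots> = (\<Sum>i\<in>?P. lam i *\<^sub>R (nc_transpose (q i) * q i)) + (\<Sum>i\<in>?M. lam i *\<^sub>R (nc_transpose (q i) * q i))"
    using assms(1) by (intro sum.union_disjoint) auto
  also have "\<dots> = (\<Sum>i\<in>?P. nc_transpose (r i) * r i) - (\<Sum>i\<in>?M. nc_transpose (r i) * r i)"
    unfolding r by (simp add: sum_negf[symmetric] diff_conv_add_uminus)
  also have "\<dots> = (\<Sum>q\<leftarrow>map r ps. nc_transpose q * q) - (\<Sum>q\<leftarrow>map r ms. nc_transpose q * q)"
    using ps ms by (simp add: sum.distinct_set_conv_list[symmetric] o_def)
  finally have "f = (\<Sum>q\<leftarrow>map r ps. nc_transpose q * q) - (\<Sum>q\<leftarrow>map r ms. nc_transpose q * q)" .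
  moreover have "length (map r ms) = card ?M" using ms distinct_card by fastforce
  ultimately show ?thesis unfolding sigma_minus_min_def by (blast intro: Least_le)
qed

section \<open>Border polynomials evaluated at matrices\<close>

lemma linear_foldr_mult_vec: "linear (foldr (\<lambda>j u. (X j :: real^'n^'n) *v u) ws)"
proof (induction ws)
  case (Cons j ws)
  show ?case
    using linear_compose[OF Cons.IH matrix_vector_mul_linear[of "X j"]] by (simp add: o_def)
qed (simp add: linear_ident)

lemma mark_singleton:
  assumes "r < length y"
  shows "letters (mark {r} y) = map Inl (take r y) @ Inr (y ! r) # map Inl (drop (Suc r) y)"
  using assms by (auto simp: mark_def nth_append nth_Cons' intro!: nth_equalityI)

lemma nc_eval_mark_singleton:
  assumes "r < length y"
  shows "nc_eval (case_sum X H) (monomial (mark {r} y)) *v v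
    = foldr (\<lambda>j u. X j *v u) (take r y) (H (y ! r) *v foldr (\<lambda>j u. X j *v u) (drop (Suc r) y) v)"
  using assms by (simp add: nc_eval_monomial mark_singleton foldr_map o_def)

lemma nc_eval_border:
  "nc_eval (case_sum X H) (border y) *v v
    = (\<Sum>r<length y. isqrt_coeff r *\<^sub>R foldr (\<lambda>j u. X j *v u) (take r y)
        (H (y ! r) *v foldr (\<lambda>j u. X j *v u) (drop (Suc r) y) v))"
  unfolding border_def
  by (simp add: linear_sum[OF linear_nc_eval_vec] linear_scale[OF linear_nc_eval_vec]
      nc_eval_mark_singleton)

text \<open>Every term of \<open>border y\<close> contains exactly one \<open>h\<close>. This
  linearity is what makes the vanishing of a square at most \<open>CARD('n)\<close> linear
  conditions on \<open>H\<close>.\<close>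

lemma linear_nc_eval_border:
  fixes X :: "'g::finite \<Rightarrow> real^'n^'n"
  shows "linear (\<lambda>H :: real^'n^'n^'g. nc_eval (case_sum X (($) H)) (border y) *v v)"
  unfolding nc_eval_border
  by (rule linearI)
    (simp_all add: matrix_vector_mult_add_rdistrib scaleR_matrix_vector_assoc[symmetric]
      linear_add[OF linear_foldr_mult_vec] linear_scale[OF linear_foldr_mult_vec]
      scaleR_add_right sum.distrib scaleR_sum_right mult.commute)

text \<open>The leading term of \<open>border (j # w)\<close> is \<open>h\<^sub>j w\<close>; the others end in shorter such words.\<close>

lemma border_kernel:
  assumes "\<And>y. y \<in> border_words d \<Longrightarrow> nc_eval (case_sum X H) (border y) *v v = 0"
    and "j # w \<in> border_words d"
  shows "H j *v foldr (\<lambda>j u. X j *v u) w v = 0"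
  using assms(2)
proof (induction w arbitrary: j rule: length_induct)
  case (1 w)
  let ?F = "\<lambda>ws u. foldr (\<lambda>j u. X j *v u) ws u"
  let ?t = "\<lambda>r. isqrt_coeff r *\<^sub>R ?F (take r (j # w)) (H ((j # w) ! r) *v ?F (drop (Suc r) (j # w)) v)"
  have "?t (Suc r) = 0" if "r < length w" for r
  proof -
    have "(w ! r) # drop (Suc r) w \<in> border_words d"
      using 1(2) that by (auto simp: border_words_def)
    then have "H (w ! r) *v ?F (drop (Suc r) w) v = 0"
      using 1(1) that by simp
    then show ?thesis by (simp add: linear_0[OF linear_foldr_mult_vec])
  qed
  then have "(\<Sum>r<length w. ?t (Suc r)) = 0" by (intro sum.neutral) auto
  \<comment> \<open>The surviving term has coefficient \<open>isqrt_coeff 0 = 1\<close>, so it is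
    the desired vector itself.\<close>
  then have "(\<Sum>r<length (j # w). ?t r) = ?t 0"
    by (simp only: length_Cons sum.lessThan_Suc_shift add_0_right)
  then show ?case using assms(1)[OF 1(2)] by (simp add: nc_eval_border)
qed

section \<open>Counting words and independence of their vectors\<close>

lemma card_lists_length_less:
  "card {w :: 'a::finite list. length w < m} = (\<Sum>i<m. CARD('a) ^ i)"
proof (cases m)
  case (Suc l)
  then show ?thesis
    using card_lists_length_le[of "UNIV :: 'a set" l] by (simp add: less_Suc_eq_le lessThan_Suc_atMost)
qed simp

lemma card_border_words:
  "card (border_words d :: 'a::finite list set) = CARD('a) * (\<Sum>i<d - 1. CARD('a) ^ i)"
proof -
  have "border_words d = (\<lambda>(j, w). j # w) ` (UNIV \<times> {w :: 'a list. length w < d - 1})"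
  proof
    show "border_words d \<subseteq> (\<lambda>(j, w). j # w) ` (UNIV \<times> {w :: 'a list. length w < d - 1})"
    proof
      fix y :: "'a list" assume "y \<in> border_words d"
      then show "y \<in> (\<lambda>(j, w). j # w) ` (UNIV \<times> {w :: 'a list. length w < d - 1})"
        by (cases y) (auto simp: border_words_def image_iff)
    qed
  qed (auto simp: border_words_def)
  then have "card (border_words d :: 'a list set) = CARD('a) * card {w :: 'a list. length w < d - 1}"
    by (simp add: card_image inj_on_def card_cartesian_product)
  then show ?thesis by (simp add: card_lists_length_less)
qed

text \<open>Independence is assumed for the indexed family, so coinciding vectors are excluded too
  and the image has as many elements as \<open>W\<close>.\<close>

lemma independent_image:
  fixes f :: "'i \<Rightarrow> 'b::real_vector"
  assumes "finite W" and zero: "\<And>c. (\<Sum>w\<in>W. c w *\<^sub>R f w) = 0 \<Longrightarrow> \<forall>w\<in>W. c w = 0"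
  shows "independent (f ` W)" "inj_on f W"
proof -
  show inj: "inj_on f W"
  proof (rule inj_onI, rule ccontr)
    fix a b assume ab: "a \<in> W" "b \<in> W" "f a = f b" "a \<noteq> b"
    let ?c = "\<lambda>w. (if w = a then 1 else 0) - (if w = b then 1 else 0) :: real"
    have "(\<Sum>w\<in>W. ?c w *\<^sub>R f w) = (\<Sum>w\<in>W. if w = a then f w else 0) - (\<Sum>w\<in>W. if w = b then f w else 0)"
      unfolding sum_subtractf[symmetric] using ab by (intro sum.cong) auto
    then have "(\<Sum>w\<in>W. ?c w *\<^sub>R f w) = 0" using ab assms(1) by simp
    from zero[OF this] ab show False by auto
  qed
  show "independent (f ` W)"
  proof
    assume "dependent (f ` W)"
    then obtain u where u: "\<exists>x\<in>f ` W. u x \<noteq> 0" "(\<Sum>x\<in>f ` W. u x *\<^sub>R x) = 0"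
      using dependent_finite[of "f ` W"] assms(1) by auto
    then have "(\<Sum>w\<in>W. u (f w) *\<^sub>R f w) = 0" by (simp add: sum.reindex[OF inj])
    from zero[OF this] u(1) show False by auto
  qed
qed

text \<open>The coefficients of a linear relation among the word vectors form a polynomial
  \<open>q\<close> that annihilates \<open>v\<close> at \<open>X\<close>.\<close>

lemma independent_word_vectors:
  fixes X :: "'g::finite \<Rightarrow> real^'n^'n"
  assumes "\<not> (\<exists>q :: 'g ncpoly. q \<noteq> 0 \<and> nc_degree q + 2 \<le> d \<and> nc_eval X q *v v = 0)"
  defines "W \<equiv> {w :: 'g list. length w < d - 1}"
  defines "f \<equiv> \<lambda>w. foldr (\<lambda>j u. X j *v u) w v"
  shows "independent (f ` W)" "inj_on f W"
proof -
  have fin: "finite W"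
    using finite_lists_length_le[of "UNIV :: 'g set" d]
    by (rule finite_subset[rotated]) (auto simp: W_def)
  have "\<forall>w\<in>W. c w = 0" if c: "(\<Sum>w\<in>W. c w *\<^sub>R f w) = 0" for c
  proof (rule ccontr)
    assume "\<not> (\<forall>w\<in>W. c w = 0)"
    then obtain w where w: "w \<in> W" "c w \<noteq> 0" by blast
    define q :: "'g ncpoly" where "q = (\<Sum>w\<in>W. c w *\<^sub>R monomial (NCWord w))"
    have lookup: "Poly_Mapping.lookup q (NCWord w) = (if w \<in> W then c w else 0)" for w
    proof -
      have "Poly_Mapping.lookup q (NCWord w) = (\<Sum>u\<in>W. if u = w then c u else 0)"
        unfolding q_def lookup_sum by (intro sum.cong) (auto simp: lookup_single when_def)
      then show ?thesis using fin by simp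
    qed
    have "nc_eval X q *v v = 0"
      using c by (simp add: q_def f_def linear_sum[OF linear_nc_eval_vec]
          linear_scale[OF linear_nc_eval_vec] nc_eval_monomial)
    moreover have "q \<noteq> 0" using lookup[of w] w by auto
    moreover have "nc_degree q + 2 \<le> d"
    proof -
      have "length (letters u) \<le> d - 2" if "u \<in> Poly_Mapping.keys q" for u
      proof -
        have "letters u \<in> W"
          using that lookup[of "letters u"] by (auto simp: in_keys_iff split: if_splits)
        then show ?thesis by (simp add: W_def)
      qed
      then have "nc_degree q \<le> d - 2" by (auto simp: nc_degree_def)
      \<comment> \<open>The word \<open>w\<close> in \<open>W\<close> guarantees
        \<open>d \<ge> 2\<close>, so the truncated \<open>d - 2\<close> is the true
        difference.\<close>
      then show ?thesis using w by (auto simp: W_def)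
    qed
    ultimately show False using assms(1) by blast
  qed
  then show "independent (f ` W)" "inj_on f W" using independent_image[OF fin] by blast+
qed

theorem theorem1p8:
  fixes p :: "'g::finite ncpoly"
    and d \<nu> k :: nat
    and X :: "real^'n^'n^'g"
    and v :: "real^'n"
    and \<H> :: "(real^'n^'n^'g) set"
  assumes "nc_symmetric p"
    and "nc_degree p = d"
    and "\<nu> = (\<Sum>i<d - 1. CARD('g) ^ i)"
    and "k > 0"
    and "real CARD('n) > real CARD('g) * (real \<nu> * (real \<nu> - 1) / 2)"
    and "X \<in> sym_tuples"
    and "\<not> (\<exists>q :: 'g ncpoly. q \<noteq> 0 \<and> nc_degree q + 2 \<le> d \<and> nc_eval (($) X) q *v v = 0)"
    and "subspace \<H>"
    and "\<H> \<subseteq> sym_tuples"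
    and "dim (sym_tuples :: (real^'n^'n^'g) set) - dim \<H> \<le> k * CARD('n)"
    and "hessian_positive_on p \<H> X v"
  shows "sigma_minus_min (nc_hessian p) < k + 1"
proof -
  let ?Y = "border_words d :: 'g list set"
  have "Poly_Mapping.lookup p (NCWord (rev y @ z)) = Poly_Mapping.lookup p (NCWord (rev z @ y))" for y z
    using assms(1) lookup_nc_transpose[of p "NCWord (rev y @ z)"] by (simp add: nc_symmetric_def)
  then have "diagonalizable_on ?Y (middle p)"
    by (intro symmetric_diagonalizable_on) (auto simp: middle_def)
  then obtain t e lam where
    t: "\<And>y z. y \<in> ?Y \<Longrightarrow> z \<in> ?Y \<Longrightarrow> (\<Sum>i\<in>?Y. t i z * e i y) = (if y = z then 1 else 0)"
    and e: "\<And>y z. y \<in> ?Y \<Longrightarrow> z \<in> ?Y \<Longrightarrow> middle p y z = (\<Sum>i\<in>?Y. lam i * e i y * e i z)"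
    unfolding diagonalizable_on_def by blast
  define Q where "Q i = (\<Sum>y\<in>?Y. e i y *\<^sub>R border y)" for i
  let ?P = "{i \<in> ?Y. lam i \<ge> 0}" and ?M = "{i \<in> ?Y. lam i < 0}"
  let ?B = "\<lambda>y z. nc_transpose (border y) * border z"
  have "nc_hessian p = (\<Sum>y\<in>?Y. \<Sum>z\<in>?Y. \<Sum>i\<in>?Y. (lam i * e i y * e i z) *\<^sub>R ?B y z)"
    unfolding nc_hessian_border[OF assms(2)] by (intro sum.cong refl) (simp add: e scaleR_sum_left)
  also have "\<dots> = (\<Sum>y\<in>?Y. \<Sum>i\<in>?Y. \<Sum>z\<in>?Y. (lam i * e i y * e i z) *\<^sub>R ?B y z)"
    by (intro sum.cong refl sum.swap)
  also have "\<dots> = (\<Sum>i\<in>?Y. \<Sum>y\<in>?Y. \<Sum>z\<in>?Y. (lam i * e i y * e i z) *\<^sub>R ?B y z)"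
    by (rule sum.swap)
  also have "\<dots> = (\<Sum>i\<in>?Y. lam i *\<^sub>R (nc_transpose (Q i) * Q i))"
    by (simp add: Q_def linear_sum[OF linear_nc_transpose] linear_scale[OF linear_nc_transpose]
        sum_product scaleR_sum_right mult_ac)
  finally have hess: "nc_hessian p = (\<Sum>i\<in>?Y. lam i *\<^sub>R (nc_transpose (Q i) * Q i))" .

  define ev where "ev H q = nc_eval (case_sum (($) X) (($) H)) q *v v"
    for H :: "real^'n^'n^'g" and q
  have lin_ev: "linear (ev H)" for H
    unfolding ev_def by (rule linear_nc_eval_vec)
  have ev_Q: "ev H (Q i) = (\<Sum>y\<in>?Y. e i y *\<^sub>R ev H (border y))" for H i
    by (simp add: Q_def linear_sum[OF lin_ev] linear_scale[OF lin_ev])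
  have "linear (\<lambda>H. ev H (border y))" for y
    unfolding ev_def by (rule linear_nc_eval_border)
  then have lin_Q: "linear (\<lambda>H. ev H (Q i))" for i
    unfolding ev_Q by (intro linear_compose_sum linear_compose_scale_right ballI)
  \<comment> \<open>As \<open>X\<close> and \<open>H\<close> are symmetric, each transposed factor
    acts as an adjoint and each square contributes a squared norm.\<close>
  have form: "ev H (nc_hessian p) \<bullet> v = (\<Sum>i\<in>?Y. lam i * (ev H (Q i) \<bullet> ev H (Q i)))"
    if "H \<in> \<H>" for H
  proof -
    have "transpose (case_sum (($) X) (($) H) j) = case_sum (($) X) (($) H) j" for j
      using that assms(6,9) by (cases j) (auto simp: sym_tuples_def)
    then have "ev H (nc_transpose q * q) \<bullet> v = ev H q \<bullet> ev H q" for q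
      by (simp add: ev_def nc_eval_mult nc_eval_transpose)
    then show ?thesis
      by (simp add: hess linear_sum[OF lin_ev] linear_scale[OF lin_ev] inner_sum_left)
  qed

  define U where "U = (\<lambda>w. foldr (\<lambda>j u. X $ j *v u) w v) ` {w. length w < d - 1}"
  \<comment> \<open>Indices with \<open>lam i = 0\<close> belong to \<open>?P\<close>: their squares
    do not enter the form, so positivity could not force them to vanish.\<close>
  let ?K = "{H \<in> \<H>. \<forall>i\<in>?P. ev H (Q i) = 0}"
  have "?K \<subseteq> sym_annihilator U"
  proof
    fix H assume H: "H \<in> ?K"
    let ?s = "\<lambda>i. lam i * (ev H (Q i) \<bullet> ev H (Q i))"
    have "0 \<le> (\<Sum>i\<in>?Y. ?s i)"
      using assms(11) H form[of H] by (auto simp: hessian_positive_on_def ev_def)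
    moreover have nonpos: "?s i \<le> 0" if "i \<in> ?Y" for i
      using H that by (cases "lam i \<ge> 0") (auto simp: mult_nonpos_nonneg)
    \<comment> \<open>On \<open>?K\<close> no term is positive, yet the sum is nonnegative, so every
      term is 0.\<close>
    ultimately have "(\<Sum>i\<in>?Y. - ?s i) = 0"
      using sum_nonpos[of ?Y ?s] by (simp add: sum_negf)
    then have "\<forall>i\<in>?Y. - ?s i = 0"
      using nonpos by (subst (asm) sum_nonneg_eq_0_iff) auto
    then have Q0: "ev H (Q i) = 0" if "i \<in> ?Y" for i
      using H that by (cases "lam i \<ge> 0") auto
    have "ev H (border z) = 0" if z: "z \<in> ?Y" for z
    proof -
      \<comment> \<open>The dual basis \<open>t\<close> recovers each border polynomial from the
        \<open>Q i\<close>.\<close>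
      have "(\<Sum>i\<in>?Y. t i z *\<^sub>R ev H (Q i)) = (\<Sum>i\<in>?Y. \<Sum>y\<in>?Y. (t i z * e i y) *\<^sub>R ev H (border y))"
        by (simp add: ev_Q scaleR_sum_right)
      also have "\<dots> = (\<Sum>y\<in>?Y. (\<Sum>i\<in>?Y. t i z * e i y) *\<^sub>R ev H (border y))"
        by (subst sum.swap) (simp add: scaleR_sum_left)
      also have "\<dots> = (\<Sum>y\<in>?Y. if y = z then ev H (border y) else 0)"
        using z t by (intro sum.cong) auto
      finally show ?thesis using Q0 z by simp
    qed
    then have "H $ j *v foldr (\<lambda>j u. X $ j *v u) w v = 0" if "length w < d - 1" for j w
      unfolding ev_def using that by (intro border_kernel[of d]) (auto simp: border_words_def)
    then show "H \<in> sym_annihilator U"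
      using H assms(9) by (auto simp: sym_annihilator_def U_def)
  qed
  then have "dim ?K \<le> dim (sym_annihilator U :: (real^'n^'n^'g) set)"
    by (rule dim_subset)
  moreover have "dim \<H> \<le> dim ?K + card ?P * CARD('n)"
    using dim_common_kernel_ge[of ?P "\<lambda>i H. ev H (Q i)" \<H>] lin_Q assms(8) by simp
  moreover have cardY: "card ?P + card ?M = CARD('g) * \<nu>"
  proof -
    have "card (?P \<union> ?M) = card ?P + card ?M" by (rule card_Un_disjoint) auto
    moreover have "?P \<union> ?M = ?Y" by auto
    ultimately show ?thesis using assms(3) by (simp add: card_border_words)
  qed
  moreover have "dim (sym_annihilator U :: (real^'n^'n^'g) set) + CARD('g) * \<nu> * CARD('n)
    \<le> dim (sym_tuples :: (real^'n^'n^'g) set) + CARD('g) * (\<Sum>i<\<nu>. i)"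
  proof -
    have "independent U" "inj_on (\<lambda>w. foldr (\<lambda>j u. X $ j *v u) w v) {w. length w < d - 1}"
      unfolding U_def using independent_word_vectors[OF assms(7)] by auto
    then show ?thesis
      using dim_sym_annihilator[of U, where 'g = 'g] assms(3)
      by (simp add: U_def card_image card_lists_length_less)
  qed
  ultimately have "card ?M * CARD('n) \<le> k * CARD('n) + CARD('g) * (\<Sum>i<\<nu>. i)"
  proof -
    assume *: "dim ?K \<le> dim (sym_annihilator U :: (real^'n^'n^'g) set)"
      "dim \<H> \<le> dim ?K + card ?P * CARD('n)"
      "dim (sym_annihilator U :: (real^'n^'n^'g) set) + CARD('g) * \<nu> * CARD('n)
        \<le> dim (sym_tuples :: (real^'n^'n^'g) set) + CARD('g) * (\<Sum>i<\<nu>. i)"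
    have "card ?P * CARD('n) + card ?M * CARD('n) = CARD('g) * \<nu> * CARD('n)"
      by (simp only: cardY[symmetric] add_mult_distrib)
    \<comment> \<open>Even with truncated subtraction, the codimension bound gives
      \<open>dim sym_tuples \<le> dim \<H> + k * CARD('n)\<close>; the terms
      \<open>CARD('g) * \<nu> * CARD('n)\<close> then cancel.\<close>
    then show ?thesis using * assms(10) by linarith
  qed
  then have "real (card ?M) * real CARD('n) \<le> real k * real CARD('n) + real CARD('g) * real (\<Sum>i<\<nu>. i)"
    by (simp only: of_nat_mult[symmetric] of_nat_add[symmetric] of_nat_le_iff)
  also have "real (\<Sum>i<\<nu>. i) = real \<nu> * (real \<nu> - 1) / 2"
    by (induction \<nu>) (auto simp: field_simps)
  \<comment> \<open>The lower bound on \<open>CARD('n)\<close> absorbs the triangular correction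
    into one further copy of \<open>CARD('n)\<close>.\<close>
  also have "real k * real CARD('n) + real CARD('g) * \<dots> < real (k + 1) * real CARD('n)"
    using assms(5) by (simp add: algebra_simps)
  finally have "card ?M < k + 1" by simp
  then show ?thesis
    using sigma_minus_min_le[OF finite_border_words hess] by linarith
qed

end
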